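(* For every $\alpha\in(0,1)$, the kernel $$\frac{1}{(1-z\overline\lambda)^\alpha},\quad z,\lambda\in\mathbb D,$$ does not have a Shimorin-type integral representation.
   Context: $\mathbb D$ is the open unit disk in $\mathbb C$; the power is the principal branch. A kernel $K:\mathbb D\times\mathbb D\to\mathbb C$ has a Shimorin-type integral representation if there exists a finite positive Borel measure $\nu$ on $[0,1]$ such that $$K(z,\lambda)=\frac{1}{1-z\overline\lambda}\int_0^1\frac{1}{1-rz\overline\lambda}\,d\nu(r)\quad\text{for all } z,\lambda\in\mathbb D.$$ *)

theory Defs
  imports "HOL-Analysis.Analysis"
begin

definition shimorin_representation :: "(complex \<Rightarrow> complex \<Rightarrow> complex) \<Rightarrow> bool" where
  "shimorin_representation K \<longleftrightarrow>
     (\<exists>\<nu> :: real measure.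
        finite_measure \<nu> \<and>
        sets \<nu> = sets (restrict_space borel {0..1}) \<and>
        (\<forall>z \<in> ball 0 1. \<forall>l \<in> ball 0 1.
           K z l = 1 / (1 - z * cnj l) *
             (LINT r|\<nu>. 1 / (1 - complex_of_real r * z * cnj l))))"

end

theory Submission
  imports Defs
begin

text \<open>
  A Shimorin-type representation at a pair \<open>z, l\<close> with \<open>z * cnj l = w \<in> [0, 1)\<close> says that
  \<open>K z l = (1 - w)\<^sup>-\<^sup>1 * \<integral> (1 - r w)\<^sup>-\<^sup>1 d\<nu>(r)\<close>. Taking \<open>w = 0\<close> shows that
  \<open>\<nu>\<close> has total mass \<open>K 0 0\<close>, which is \<open>1\<close> for the kernel at hand. As
  \<open>(1 - r w)\<^sup>-\<^sup>1 \<ge> 1\<close> for \<open>r \<in> [0, 1]\<close>, the representation then forces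
  \<open>K z l \<ge> (1 - w)\<^sup>-\<^sup>1\<close>, whereas \<open>(1 - w)\<^sup>-\<^sup>\<alpha> < (1 - w)\<^sup>-\<^sup>1\<close> for \<open>0 < w < 1\<close> and
  \<open>\<alpha> < 1\<close>. The point \<open>z = l = 1/2\<close>, where \<open>w = 1/4\<close>, suffices.
\<close>

lemma integral_inverse_one_minus_ge_measure:
  fixes \<nu> :: "real measure" and w :: real
  assumes "finite_measure \<nu>"
    and sets: "sets \<nu> = sets (restrict_space borel {0..1})"
    and w: "0 \<le> w" "w < 1"
  shows "measure \<nu> (space \<nu>) \<le> (LINT r|\<nu>. 1 / (1 - r * w))"
proof -
  interpret finite_measure \<nu> by fact
  have space: "space \<nu> = {0..1}"
    using sets_eq_imp_space_eq[OF sets] by (simp add: space_restrict_space)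
  have bounds: "1 \<le> 1 / (1 - r * w)" "1 / (1 - r * w) \<le> 1 / (1 - w)" if "r \<in> space \<nu>" for r
  proof -
    have "0 \<le> r * w" "r * w \<le> w"
      using that w by (auto simp: space intro: mult_left_le_one_le)
    then show "1 \<le> 1 / (1 - r * w)" "1 / (1 - r * w) \<le> 1 / (1 - w)"
      using w by (auto simp: field_simps)
  qed
  have "(\<lambda>r. 1 / (1 - r * w)) \<in> borel_measurable (restrict_space borel {0..1})"
    by (intro measurable_restrict_space1) measurable
  then have meas: "(\<lambda>r. 1 / (1 - r * w)) \<in> borel_measurable \<nu>"
    using measurable_cong_sets[OF sets refl] by blast
  have int: "integrable \<nu> (\<lambda>r. 1 / (1 - r * w))"
  proof (rule integrable_const_bound[OF _ meas])
    have "norm (1 / (1 - r * w)) \<le> 1 / (1 - w)" if "r \<in> space \<nu>" for r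
      using bounds[OF that] unfolding real_norm_def by linarith
    then show "AE r in \<nu>. norm (1 / (1 - r * w)) \<le> 1 / (1 - w)"
      by (intro AE_I2)
  qed
  have "(LINT r|\<nu>. 1) \<le> (LINT r|\<nu>. 1 / (1 - r * w))"
    by (rule integral_mono[OF _ int]) (use bounds in auto)
  then show ?thesis by simp
qed

theorem mainTheorem6:
  fixes \<alpha> :: real
  assumes "0 < \<alpha>" and "\<alpha> < 1"
  shows "\<not> shimorin_representation
           (\<lambda>z l. 1 / (1 - z * cnj l) powr complex_of_real \<alpha>)"
proof
  assume "shimorin_representation (\<lambda>z l. 1 / (1 - z * cnj l) powr complex_of_real \<alpha>)"
  then obtain \<nu> :: "real measure" where fin: "finite_measure \<nu>"
    and sets: "sets \<nu> = sets (restrict_space borel {0..1})"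
    and rep: "\<And>z l. z \<in> ball 0 1 \<Longrightarrow> l \<in> ball 0 1 \<Longrightarrow>
      1 / (1 - z * cnj l) powr complex_of_real \<alpha> = 1 / (1 - z * cnj l) *
        (LINT r|\<nu>. 1 / (1 - complex_of_real r * z * cnj l))"
    unfolding shimorin_representation_def by blast
  define J where "J = (LINT r|\<nu>. 1 / (1 - r * (1/4)))"
  have mass: "measure \<nu> (space \<nu>) = 1"
  proof -
    have "complex_of_real (measure \<nu> (space \<nu>)) = 1"
      using rep[of 0 0] by (simp add: scaleR_conv_of_real)
    then show ?thesis by (simp only: of_real_eq_1_iff)
  qed
  have "1 \<le> J"
    using integral_inverse_one_minus_ge_measure[OF fin sets, of "1/4"] mass
    by (simp add: J_def)
  have "(LINT r|\<nu>. 1 / (1 - complex_of_real r * (1/2) * cnj (1/2)))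
      = (LINT r|\<nu>. complex_of_real (1 / (1 - r * (1/4))))"
    by (intro Bochner_Integration.integral_cong) auto
  also have "\<dots> = complex_of_real J"
    unfolding J_def by (rule integral_complex_of_real)
  finally have "1 / (1 - (1/2) * cnj (1/2)) powr complex_of_real \<alpha>
      = 1 / (1 - (1/2) * cnj (1/2)) * complex_of_real J"
    using rep[of "1/2" "1/2"] by (simp add: norm_divide)
  moreover have "1 - (1/2) * cnj (1/2) = complex_of_real (3/4)"
    by simp
  ultimately have "1 / complex_of_real (3/4) powr complex_of_real \<alpha>
      = 1 / complex_of_real (3/4) * complex_of_real J"
    by metis
  moreover have "complex_of_real (3/4) powr complex_of_real \<alpha> = complex_of_real ((3/4) powr \<alpha>)"
    by (rule powr_of_real) auto
  ultimately have "complex_of_real (1 / (3/4) powr \<alpha>) = complex_of_real (1 / (3/4) * J)"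
    by (simp only: of_real_divide of_real_mult of_real_1)
  then have eq: "1 / (3/4) powr \<alpha> = 1 / (3/4) * J"
    by (simp only: of_real_eq_iff)
  have "(3/4) powr 1 < (3/4 :: real) powr \<alpha>"
    using assms by (intro powr_less_mono') auto
  then have "1 / (3/4) powr \<alpha> < 1 / (3/4 :: real)"
    by (intro divide_strict_left_mono) auto
  with eq \<open>1 \<le> J\<close> show False by simp
qed

end
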